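(* Let $k\ge 1$ be an integer. Then $$\mathrm{Card}\big(\{d\in A_k : d \text{ is symmetric}\}\big)=\sum_{\lambda\in\Gamma_k} m_k^\lambda .$$
   Context: $A_k$ is the set of set partitions of $\{1,\ldots,k,1',\ldots,k'\}$. For $d\in A_k$, $\mathrm{flip}(d)$ is the set partition obtained by exchanging $i$ and $i'$ for every $1\le i\le k$; $d$ is symmetric if $d=\mathrm{flip}(d)$. $\Gamma_k$ is the set of all integer partitions $\lambda$ with $0\le|\lambda|\le k$, identified with Young diagrams. $m_k^\lambda$ is the number of vacillating tableaux of shape $\lambda$ and length $2k$, i.e. of sequences of partitions $(\emptyset=\lambda^{(0)},\lambda^{(1/2)},\lambda^{(1)},\ldots,\lambda^{(k-1/2)},\lambda^{(k)}=\lambda)$ such that for each integer $0\le i\le k-1$: $\lambda^{(i+1/2)}$ equals $\lambda^{(i)}$ or is obtained from it by removing one box; and $\lambda^{(i+1)}$ equals $\lambda^{(i+1/2)}$ or is obtained from it by adding one box. *)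

theory Defs
  imports Main "HOL-Library.Disjoint_Sets"
begin

(* The vertex i is encoded as Inl i and the vertex i' as Inr i. *)

definition vertices :: "nat \<Rightarrow> (nat + nat) set" where
  "vertices k = {1..k} <+> {1..k}"

definition set_partitions :: "nat \<Rightarrow> (nat + nat) set set set" where
  "set_partitions k = {d. partition_on (vertices k) d}"

fun swap_vertex :: "nat + nat \<Rightarrow> nat + nat" where
  "swap_vertex (Inl i) = Inr i"
| "swap_vertex (Inr i) = Inl i"

definition flip :: "(nat + nat) set set \<Rightarrow> (nat + nat) set set" where
  "flip d = (\<lambda>B. swap_vertex ` B) ` d"

definition symmetric :: "(nat + nat) set set \<Rightarrow> bool" where
  "symmetric d \<longleftrightarrow> d = flip d"

(* An integer partition is the weakly decreasing list of its positive parts;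
   its size is sum_list. *)

definition int_partition :: "nat list \<Rightarrow> bool" where
  "int_partition l \<longleftrightarrow> sorted_wrt (\<ge>) l \<and> 0 \<notin> set l"

definition Gamma :: "nat \<Rightarrow> nat list set" where
  "Gamma k = {l. int_partition l \<and> sum_list l \<le> k}"

definition young_diagram :: "nat list \<Rightarrow> (nat \<times> nat) set" where
  "young_diagram l = {(i, j). i < length l \<and> j < l ! i}"

definition add_box :: "nat list \<Rightarrow> nat list \<Rightarrow> bool" where
  "add_box l m \<longleftrightarrow> (\<exists>b. b \<notin> young_diagram l \<and> young_diagram m = insert b (young_diagram l))"

definition remove_box :: "nat list \<Rightarrow> nat list \<Rightarrow> bool" where
  "remove_box l m \<longleftrightarrow> (\<exists>b. b \<in> young_diagram l \<and> young_diagram m = young_diagram l - {b})"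

(* Entry number j of the list t is the partition with superscript (j/2). *)

definition vacillating_tableaux :: "nat \<Rightarrow> nat list \<Rightarrow> nat list list set" where
  "vacillating_tableaux k l = {t.
     length t = 2 * k + 1 \<and>
     (\<forall>p \<in> set t. int_partition p) \<and>
     t ! 0 = [] \<and> t ! (2 * k) = l \<and>
     (\<forall>i < k.
        (t ! (2 * i + 1) = t ! (2 * i) \<or> remove_box (t ! (2 * i)) (t ! (2 * i + 1))) \<and>
        (t ! (2 * i + 2) = t ! (2 * i + 1) \<or> add_box (t ! (2 * i + 1)) (t ! (2 * i + 2))))}"

definition num_vacillating_tableaux :: "nat \<Rightarrow> nat list \<Rightarrow> nat" where
  "num_vacillating_tableaux k l = card (vacillating_tableaux k l)"

end

theory Submission
  imports Defs
begin

text \<open>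
  Let \<open>U\<close> and \<open>D\<close> add and remove a box in all possible ways. Read from its first step on,
  a vacillating tableau is a word in \<open>(1 + D)(1 + U)\<close>, so the number of tableaux of length
  \<open>2m\<close> starting at \<open>\<lambda>\<close> and ending anywhere is a linear functional of \<open>\<lambda>\<close>. Let \<open>R b \<lambda>\<close> be the
  number of \<open>b\<close>-step walks from \<open>\<lambda>\<close> that stay or remove a box in each step. From
  \<open>DU - UD = 1\<close>, and from the fact that a diagram has one more addable than removable corner,
  summing \<open>R b\<close> over one stay-or-remove step followed by one stay-or-add step gives
  \<open>R (b + 1) + R (b + 2) + b R b\<close>. A symmetric set partition with \<open>b\<close> blocks obeys the same
  rule when the vertices \<open>a\<close> and \<open>a'\<close> are added: it extends by the block \<open>{a, a'}\<close>, by the two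
  blocks \<open>{a}\<close> and \<open>{a'}\<close>, or by putting \<open>a\<close> into one of its \<open>b\<close> blocks and \<open>a'\<close> into the
  mirror image of that block. Hence the number of tableaux from \<open>\<lambda>\<close> is the sum of \<open>R (card d) \<lambda>\<close>
  over all symmetric \<open>d\<close>, and \<open>R b\<close> is \<open>1\<close> at the empty diagram.
\<close>

section \<open>Walks in Young's lattice\<close>

text \<open>A Young diagram is given by its function of row lengths.\<close>

definition young :: "(nat \<Rightarrow> nat) \<Rightarrow> bool" where
  "young f \<longleftrightarrow> antimono f \<and> (\<exists>n. f n = 0)"

definition addable :: "(nat \<Rightarrow> nat) \<Rightarrow> nat set" where
  "addable f = {i. i = 0 \<or> f i < f (i - 1)}"

definition removable :: "(nat \<Rightarrow> nat) \<Rightarrow> nat set" where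
  "removable f = {i. f (Suc i) < f i}"

definition inc :: "(nat \<Rightarrow> nat) \<Rightarrow> nat \<Rightarrow> nat \<Rightarrow> nat" where
  "inc f i = f(i := Suc (f i))"

definition dec :: "(nat \<Rightarrow> nat) \<Rightarrow> nat \<Rightarrow> nat \<Rightarrow> nat" where
  "dec f i = f(i := f i - 1)"

text \<open>The operators act on functions of the diagram, not on formal sums of diagrams. In a
  composition the outermost operator is therefore the first step of the walk.\<close>

definition stay_or_add :: "((nat \<Rightarrow> nat) \<Rightarrow> nat) \<Rightarrow> (nat \<Rightarrow> nat) \<Rightarrow> nat" where
  "stay_or_add \<phi> f = \<phi> f + (\<Sum>i\<in>addable f. \<phi> (inc f i))"

definition stay_or_remove :: "((nat \<Rightarrow> nat) \<Rightarrow> nat) \<Rightarrow> (nat \<Rightarrow> nat) \<Rightarrow> nat" where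
  "stay_or_remove \<phi> f = \<phi> f + (\<Sum>i\<in>removable f. \<phi> (dec f i))"

definition removal_walks :: "nat \<Rightarrow> (nat \<Rightarrow> nat) \<Rightarrow> nat" where
  "removal_walks b = (stay_or_remove ^^ b) (\<lambda>_. 1)"

text \<open>Starting the iteration from the constant 1 leaves the endpoint free: this counts walks
  of \<open>m\<close> rounds, each removing before it adds.\<close>

definition vacillating_walks :: "nat \<Rightarrow> (nat \<Rightarrow> nat) \<Rightarrow> nat" where
  "vacillating_walks m = ((stay_or_remove \<circ> stay_or_add) ^^ m) (\<lambda>_. 1)"

lemma removal_walks_simps [simp]:
  "removal_walks 0 f = 1"
  "removal_walks (Suc b) f = stay_or_remove (removal_walks b) f"
  by (simp_all add: removal_walks_def)

lemma vacillating_walks_simps [simp]: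
  "vacillating_walks 0 f = 1"
  "vacillating_walks (Suc m) f = stay_or_remove (stay_or_add (vacillating_walks m)) f"
  by (simp_all add: vacillating_walks_def)

lemma youngI: "(\<And>i. f (Suc i) \<le> f i) \<Longrightarrow> f n = 0 \<Longrightarrow> young f"
  unfolding young_def antimono_def using lift_Suc_antimono_le[of f] by blast

lemma young_Suc_le: "young f \<Longrightarrow> f (Suc i) \<le> f i"
  by (simp add: young_def antimonoD)

lemma young_eventually_zero:
  assumes "young f"
  obtains n where "\<And>i. i \<ge> n \<Longrightarrow> f i = 0"
  using assms unfolding young_def antimono_def by (metis le_zero_eq)

lemma finite_removable: "young f \<Longrightarrow> finite (removable f)"
proof -
  assume "young f"
  then obtain n where n: "\<And>i. i \<ge> n \<Longrightarrow> f i = 0" by (rule young_eventually_zero) blast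
  have "i < n" if "i \<in> removable f" for i
    using that n[of i] by (cases "i < n") (simp_all add: removable_def)
  then have "removable f \<subseteq> {..<n}" by auto
  then show ?thesis by (rule finite_subset) simp
qed

text \<open>A box fits at the end of a row below the top one exactly when the row above is strictly
  longer, that is, ends in a removable corner. The top row always accepts a box, hence the surplus
  of one in \<open>card_addable\<close>.\<close>

lemma addable_eq: "addable f = insert 0 (Suc ` removable f)"
proof (rule set_eqI)
  show "i \<in> addable f \<longleftrightarrow> i \<in> insert 0 (Suc ` removable f)" for i
    by (cases i) (auto simp: addable_def removable_def)
qed

lemma finite_addable: "young f \<Longrightarrow> finite (addable f)"
  by (simp add: addable_eq finite_removable)

lemma card_addable: "young f \<Longrightarrow> card (addable f) = Suc (card (removable f))"
  by (simp add: addable_eq finite_removable card_image)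

lemma young_inc: "young f \<Longrightarrow> i \<in> addable f \<Longrightarrow> young (inc f i)"
proof -
  assume f: "young f" and i: "i \<in> addable f"
  obtain n where n: "\<And>i. i \<ge> n \<Longrightarrow> f i = 0" using f by (rule young_eventually_zero) blast
  have "inc f i (Suc j) \<le> inc f i j" for j
    using young_Suc_le[OF f, of j] i by (auto simp: inc_def addable_def)
  moreover have "inc f i (Suc (n + i)) = 0" using n by (simp add: inc_def)
  ultimately show ?thesis by (rule youngI)
qed

lemma young_dec: "young f \<Longrightarrow> i \<in> removable f \<Longrightarrow> young (dec f i)"
proof -
  assume f: "young f" and i: "i \<in> removable f"
  obtain n where n: "\<And>i. i \<ge> n \<Longrightarrow> f i = 0" using f by (rule young_eventually_zero) blast
  have "dec f i (Suc j) \<le> dec f i j" for j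
    using young_Suc_le[OF f, of j] i by (auto simp: dec_def removable_def)
  moreover have "dec f i (Suc (n + i)) = 0" using n by (simp add: dec_def)
  ultimately show ?thesis by (rule youngI)
qed

text \<open>The identities between walk counts are proved for Young diagrams only, so rewriting
  under the operator relies on \<open>young\<close> being preserved by each step.\<close>

lemma stay_or_remove_cong:
  assumes "young f" "\<And>g. young g \<Longrightarrow> \<phi> g = \<psi> g"
  shows "stay_or_remove \<phi> f = stay_or_remove \<psi> f"
  unfolding stay_or_remove_def using assms young_dec by (auto intro!: sum.cong)

lemma stay_or_add_cong:
  assumes "young f" "\<And>g. young g \<Longrightarrow> \<phi> g = \<psi> g"
  shows "stay_or_add \<phi> f = stay_or_add \<psi> f"
  unfolding stay_or_add_def using assms young_inc by (auto intro!: sum.cong)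

lemma stay_or_remove_linear:
  "stay_or_remove (\<lambda>g. \<phi> g + \<psi> g) f = stay_or_remove \<phi> f + stay_or_remove \<psi> f"
  "stay_or_remove (\<lambda>g. c * \<phi> g) f = c * stay_or_remove \<phi> f"
  "stay_or_remove (\<lambda>g. \<Sum>d\<in>S. F d g) f = (\<Sum>d\<in>S. stay_or_remove (F d) f)"
  unfolding stay_or_remove_def
  by (simp_all add: sum.distrib sum_distrib_left distrib_left sum.swap[of _ S "removable f"])

lemma stay_or_add_sum:
  "stay_or_add (\<lambda>g. \<Sum>d\<in>S. F d g) f = (\<Sum>d\<in>S. stay_or_add (F d) f)"
  unfolding stay_or_add_def by (simp add: sum.distrib sum.swap[of _ S "addable f"])

text \<open>The relation \<open>DU - UD = 1\<close> of Young's lattice.\<close>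

lemma sum_inc_dec:
  assumes f: "young f"
  shows "(\<Sum>i\<in>addable f. \<Sum>j\<in>removable (inc f i). \<phi> (dec (inc f i) j))
    = (\<Sum>j\<in>removable f. \<Sum>i\<in>addable (dec f j). \<phi> (inc (dec f j) i)) + (\<phi> f :: nat)"
proof -
  let ?A = "addable f" and ?R = "removable f"
  let ?up = "SIGMA i:?A. removable (inc f i) - {i}"
  let ?down = "SIGMA j:?R. addable (dec f j) - {j}"
  \<comment> \<open>In different rows, adding and removing commute, also when the two rows are
    adjacent. This matches the off-diagonal terms of both double sums.\<close>
  have sw: "i \<in> ?A \<and> j \<in> removable (inc f i) \<longleftrightarrow> j \<in> ?R \<and> i \<in> addable (dec f j)" if "i \<noteq> j" for i j
    using that by (cases i) (auto simp: addable_def removable_def inc_def dec_def split: if_splits)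
  have eq: "dec (inc f i) j = inc (dec f j) i" if "i \<noteq> j" for i j
    using that by (simp add: inc_def dec_def fun_eq_iff)
  \<comment> \<open>The diagonal terms return to \<open>f\<close>: one for each addable row here,
    one for each removable row in \<open>diagR\<close>. By \<open>card_addable\<close> these numbers
    differ by one, which is the extra term \<open>\<phi> f\<close>.\<close>
  have diagA: "i \<in> removable (inc f i)" "dec (inc f i) i = f" for i
    using young_Suc_le[OF f, of i] by (auto simp: removable_def inc_def dec_def)
  have diagR: "j \<in> addable (dec f j)" "inc (dec f j) j = f" if "j \<in> ?R" for j
    using that young_Suc_le[OF f, of "j - 1"]
    by (cases j; auto simp: addable_def removable_def inc_def dec_def)+
  have "(\<Sum>i\<in>?A. \<Sum>j\<in>removable (inc f i). \<phi> (dec (inc f i) j))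
      = (\<Sum>i\<in>?A. \<phi> f + (\<Sum>j\<in>removable (inc f i) - {i}. \<phi> (dec (inc f i) j)))"
    by (intro sum.cong refl, subst sum.remove[OF finite_removable[OF young_inc[OF f]] diagA(1)])
       (simp_all add: diagA(2))
  also have "\<dots> = card ?A * \<phi> f + (\<Sum>(i, j)\<in>?up. \<phi> (dec (inc f i) j))"
    by (simp add: sum.distrib sum.Sigma finite_addable[OF f] finite_removable[OF young_inc[OF f]])
  also have "(\<Sum>(i, j)\<in>?up. \<phi> (dec (inc f i) j)) = (\<Sum>(j, i)\<in>?down. \<phi> (inc (dec f j) i))"
  proof (rule sum.reindex_bij_witness[of _ prod.swap prod.swap])
    fix p assume "p \<in> ?up"
    then obtain i j where p: "p = (i, j)" "i \<noteq> j" "i \<in> ?A" "j \<in> removable (inc f i)"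
      by (cases p) auto
    show "prod.swap p \<in> ?down"
      "(case prod.swap p of (j, i) \<Rightarrow> \<phi> (inc (dec f j) i)) = (case p of (i, j) \<Rightarrow> \<phi> (dec (inc f i) j))"
      using p sw[OF p(2)] eq[OF p(2)] by simp_all
  next
    fix p assume "p \<in> ?down"
    then obtain i j where p: "p = (j, i)" "i \<noteq> j" "j \<in> ?R" "i \<in> addable (dec f j)"
      by (cases p) auto
    show "prod.swap p \<in> ?up" using p sw[OF p(2)] by simp
  qed simp_all
  finally have 1: "(\<Sum>i\<in>?A. \<Sum>j\<in>removable (inc f i). \<phi> (dec (inc f i) j))
      = card ?A * \<phi> f + (\<Sum>(j, i)\<in>?down. \<phi> (inc (dec f j) i))" .
  have "(\<Sum>j\<in>?R. \<Sum>i\<in>addable (dec f j). \<phi> (inc (dec f j) i))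
      = (\<Sum>j\<in>?R. \<phi> f + (\<Sum>i\<in>addable (dec f j) - {j}. \<phi> (inc (dec f j) i)))"
    by (intro sum.cong refl, subst sum.remove[OF finite_addable[OF young_dec[OF f]] diagR(1)])
       (simp_all add: diagR(2))
  also have "\<dots> = card ?R * \<phi> f + (\<Sum>(j, i)\<in>?down. \<phi> (inc (dec f j) i))"
    by (simp add: sum.distrib sum.Sigma finite_removable[OF f] finite_addable[OF young_dec[OF f]])
  finally show ?thesis using 1 by (simp add: card_addable[OF f])
qed

text \<open>Moving the added box past each of the \<open>b\<close> stay-or-remove steps produces one
  commutator term, a walk with one step fewer. For \<open>b = 0\<close> the count of addable rows is
  one plus the count of removable rows, which is \<open>removal_walks 1 f\<close>.\<close>

lemma sum_inc_removal_walks: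
  "young f \<Longrightarrow> (\<Sum>i\<in>addable f. removal_walks b (inc f i))
    = removal_walks (Suc b) f + b * removal_walks (b - 1) f"
proof (induction b arbitrary: f)
  case 0
  then show ?case by (simp add: stay_or_remove_def card_addable)
next
  case (Suc b)
  let ?R = "removal_walks"
  have "(\<Sum>i\<in>addable f. ?R (Suc b) (inc f i)) = (\<Sum>i\<in>addable f. ?R b (inc f i))
     + (\<Sum>j\<in>removable f. \<Sum>i\<in>addable (dec f j). ?R b (inc (dec f j) i)) + ?R b f"
    by (simp add: stay_or_remove_def[of "?R b"] sum.distrib sum_inc_dec[OF Suc.prems])
  also have "(\<Sum>j\<in>removable f. \<Sum>i\<in>addable (dec f j). ?R b (inc (dec f j) i))
     = (\<Sum>j\<in>removable f. ?R (Suc b) (dec f j) + b * ?R (b - 1) (dec f j))"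
    by (intro sum.cong refl Suc.IH young_dec[OF Suc.prems])
  also have "(\<Sum>i\<in>addable f. ?R b (inc f i)) = ?R (Suc b) f + b * ?R (b - 1) f"
    by (rule Suc.IH[OF Suc.prems])
  finally have "(\<Sum>i\<in>addable f. ?R (Suc b) (inc f i))
     = ?R (Suc (Suc b)) f + b * stay_or_remove (?R (b - 1)) f + ?R b f"
    by (simp add: stay_or_remove_def sum.distrib sum_distrib_left algebra_simps)
  \<comment> \<open>The factor \<open>b\<close> hides the truncated subtraction: at
    \<open>b = 0\<close> both sides vanish.\<close>
  moreover have "b * stay_or_remove (?R (b - 1)) f = b * ?R b f"
    by (cases b) simp_all
  ultimately show ?case by simp
qed

text \<open>A further \<open>stay_or_remove\<close>, applied to the formula of
  \<open>sum_inc_removal_walks\<close>, lengthens every removal walk by one step. The three terms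
  are the ones that match the three ways of extending a symmetric partition with \<open>b\<close>
  blocks.\<close>

lemma stay_or_remove_add_removal_walks:
  assumes "young f"
  shows "stay_or_remove (stay_or_add (removal_walks b)) f
    = removal_walks (b + 1) f + removal_walks (b + 2) f + b * removal_walks b f"
proof -
  let ?R = "removal_walks"
  have "stay_or_remove (stay_or_add (?R b)) f
      = stay_or_remove (\<lambda>g. (?R b g + ?R (Suc b) g) + b * ?R (b - 1) g) f"
    using assms by (intro stay_or_remove_cong)
      (simp_all add: stay_or_add_def sum_inc_removal_walks del: removal_walks_simps)
  also have "\<dots> = ?R (b + 1) f + ?R (b + 2) f + b * stay_or_remove (?R (b - 1)) f"
    by (simp add: stay_or_remove_linear[of _ _ f] flip: removal_walks_simps(2))
  also have "b * stay_or_remove (?R (b - 1)) f = b * ?R b f"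
    by (cases b) simp_all
  finally show ?thesis .
qed

section \<open>Symmetric set partitions\<close>

text \<open>The vertex set is a parameter so that an induction can add one mirror pair at a
  time.\<close>

definition symmetric_partitions :: "(nat + nat) set \<Rightarrow> (nat + nat) set set set" where
  "symmetric_partitions V = {d. partition_on V d \<and> flip d = d}"

lemma swap_vertex_swap_vertex [simp]: "swap_vertex (swap_vertex x) = x"
  by (cases x) auto

lemma swap_vertex_eq_iff [simp]: "swap_vertex x = swap_vertex y \<longleftrightarrow> x = y"
  by (metis swap_vertex_swap_vertex)

lemma swap_vertex_neq [simp]: "swap_vertex x \<noteq> x" "x \<noteq> swap_vertex x"
  by (cases x; simp)+

lemma mem_swap_vertex_image [simp]: "x \<in> swap_vertex ` B \<longleftrightarrow> swap_vertex x \<in> B"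
  by (metis image_iff swap_vertex_swap_vertex)

lemma swap_vertex_image_image [simp]: "swap_vertex ` swap_vertex ` B = B"
  by (simp add: image_image)

text \<open>One inclusion suffices because the swap is an involution.\<close>

lemma flip_eq_iff: "flip d = d \<longleftrightarrow> (\<forall>B\<in>d. swap_vertex ` B \<in> d)"
  unfolding flip_def by (auto simp: image_iff) (metis swap_vertex_image_image)

lemma partition_on_block_eq:
  "partition_on V d \<Longrightarrow> B \<in> d \<Longrightarrow> C \<in> d \<Longrightarrow> x \<in> B \<Longrightarrow> x \<in> C \<Longrightarrow> B = C"
  by (auto simp: partition_on_def disjoint_def)

lemma finite_symmetric_partitions: "finite V \<Longrightarrow> finite (symmetric_partitions V)"
  unfolding symmetric_partitions_def
  by (rule finite_subset[OF _ finitely_many_partition_on]) auto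

text \<open>When \<open>B\<close> is its own mirror image, it receives both new vertices.\<close>

definition join_block ::
  "nat + nat \<Rightarrow> (nat + nat) set \<Rightarrow> (nat + nat) set \<Rightarrow> (nat + nat) set" where
  "join_block a B C = C \<union> (if C = B then {a} else {}) \<union> (if C = swap_vertex ` B then {swap_vertex a} else {})"

text \<open>Common left inverse of the three kinds of extension. The empty set is removed because a
  block made up of new vertices only becomes empty.\<close>

definition restrict_partition ::
  "nat + nat \<Rightarrow> (nat + nat) set set \<Rightarrow> (nat + nat) set set" where
  "restrict_partition a e = (\<lambda>C. C - {a, swap_vertex a}) ` e - {{}}"

section \<open>Extending symmetric partitions by a mirror pair of vertices\<close>

context
  fixes V :: "(nat + nat) set" and a :: "nat + nat"
  assumes a: "a \<notin> V" "swap_vertex a \<notin> V"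
begin

lemma not_in_block:
  assumes "d \<in> symmetric_partitions V" "B \<in> d"
  shows "a \<notin> B" "swap_vertex a \<notin> B"
  using assms a by (auto simp: symmetric_partitions_def partition_on_def)

lemma insert_pair_symmetric:
  assumes d: "d \<in> symmetric_partitions V"
  shows "insert {a, swap_vertex a} d \<in> symmetric_partitions (insert a (insert (swap_vertex a) V))"
  using d not_in_block[OF d] a
  by (auto simp: symmetric_partitions_def flip_eq_iff partition_on_def pairwise_insert disjnt_def)

lemma insert_singletons_symmetric:
  assumes d: "d \<in> symmetric_partitions V"
  shows "insert {a} (insert {swap_vertex a} d)
    \<in> symmetric_partitions (insert a (insert (swap_vertex a) V))"
  using d not_in_block[OF d] a
  by (auto simp: symmetric_partitions_def flip_eq_iff partition_on_def pairwise_insert disjnt_def)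

lemma join_block_minus:
  assumes d: "d \<in> symmetric_partitions V" and "C \<in> d"
  shows "join_block a B C - {a, swap_vertex a} = C"
  using not_in_block[OF d \<open>C \<in> d\<close>] by (auto simp: join_block_def)

lemma mem_join_block:
  assumes "d \<in> symmetric_partitions V" "C \<in> d"
  shows "a \<in> join_block a B C \<longleftrightarrow> C = B"
  using not_in_block[OF assms] by (simp add: join_block_def)

lemma join_block_symmetric:
  assumes d: "d \<in> symmetric_partitions V" and B: "B \<in> d"
  shows "join_block a B ` d \<in> symmetric_partitions (insert a (insert (swap_vertex a) V))"
proof -
  have part: "partition_on V d" and sw: "\<And>C. C \<in> d \<Longrightarrow> swap_vertex ` C \<in> d"
    using d by (auto simp: symmetric_partitions_def flip_eq_iff)
  note nin = not_in_block[OF d]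
  have "partition_on (insert a (insert (swap_vertex a) V)) (join_block a B ` d)"
  proof (rule partition_onI)
    show "\<Union> (join_block a B ` d) = insert a (insert (swap_vertex a) V)"
      using part B sw[OF B] by (auto simp: partition_on_def join_block_def split: if_splits)
    show "{} \<notin> join_block a B ` d"
      using part by (auto simp: partition_on_def join_block_def)
    fix p q assume "p \<in> join_block a B ` d" "q \<in> join_block a B ` d" "p \<noteq> q"
    then obtain P Q where PQ: "P \<in> d" "Q \<in> d" "p = join_block a B P" "q = join_block a B Q" "P \<noteq> Q"
      by auto
    then have "P \<inter> Q = {}" using part by (auto simp: partition_on_def disjoint_def)
    then show "disjnt p q"
      using PQ nin[OF PQ(1)] nin[OF PQ(2)] by (auto simp: join_block_def disjnt_def)
  qed
  \<comment> \<open>Mirroring exchanges the roles of \<open>B\<close> and its mirror image as well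
    as those of the two new vertices, so joining commutes with it. Symmetry of the joined partition
    follows.\<close>
  moreover have "swap_vertex ` join_block a B C = join_block a B (swap_vertex ` C)" for C
  proof -
    have "swap_vertex ` C = B \<longleftrightarrow> C = swap_vertex ` B" by auto
    moreover have "swap_vertex ` C = swap_vertex ` B \<longleftrightarrow> C = B"
      by (metis swap_vertex_image_image)
    ultimately show ?thesis by (auto simp: join_block_def image_Un)
  qed
  ultimately show ?thesis
    using sw by (auto simp: symmetric_partitions_def flip_eq_iff)
qed

text \<open>The blocks of \<open>d\<close> avoid both new vertices, so deleting these undoes each
  extension. This is the source of injectivity in the later count.\<close>

lemma restrict_partition_extensions:
  assumes d: "d \<in> symmetric_partitions V"
  shows "restrict_partition a (insert {a, swap_vertex a} d) = d"
    and "restrict_partition a (insert {a} (insert {swap_vertex a} d)) = d"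
    and "restrict_partition a (join_block a B ` d) = d"
proof -
  have "{} \<notin> d" using d by (auto simp: symmetric_partitions_def partition_on_def)
  moreover have "(\<lambda>C. C - {a, swap_vertex a}) ` d = d"
    using not_in_block[OF d] by force
  ultimately show "restrict_partition a (insert {a, swap_vertex a} d) = d"
    "restrict_partition a (insert {a} (insert {swap_vertex a} d)) = d"
    by (auto simp: restrict_partition_def)
  have "(\<lambda>C. C - {a, swap_vertex a}) ` join_block a B ` d = d"
    using join_block_minus[OF d] by (auto simp: image_image)
  then show "restrict_partition a (join_block a B ` d) = d"
    using \<open>{} \<notin> d\<close> by (auto simp: restrict_partition_def)
qed

lemma restrict_partition_symmetric:
  assumes e: "e \<in> symmetric_partitions (insert a (insert (swap_vertex a) V))"
  shows "restrict_partition a e \<in> symmetric_partitions V"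
proof -
  have part: "partition_on (insert a (insert (swap_vertex a) V)) e"
    and sw: "\<And>C. C \<in> e \<Longrightarrow> swap_vertex ` C \<in> e"
    using e by (auto simp: symmetric_partitions_def flip_eq_iff)
  have "partition_on V (restrict_partition a e)"
    using partition_on_transform[OF part, of "\<lambda>C. C - {a, swap_vertex a}"] a
    by (auto simp: restrict_partition_def disjnt_def insert_Diff_if)
  moreover have "swap_vertex ` (C - {a, swap_vertex a}) = swap_vertex ` C - {a, swap_vertex a}" for C
    by (auto simp: set_eq_iff)
  ultimately show ?thesis using sw
    by (auto simp: symmetric_partitions_def flip_eq_iff restrict_partition_def)
qed

text \<open>The cases depend on what is left of the block \<open>A\<close> of \<open>a\<close> once
  both new vertices are deleted. If nothing is left, \<open>A\<close> is the pair or a singleton.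
  Otherwise the remainder is the block that \<open>a\<close> joined, and symmetry places the mirror
  vertex in the mirror block.\<close>

lemma symmetric_partition_cases:
  assumes e: "e \<in> symmetric_partitions (insert a (insert (swap_vertex a) V))"
  obtains d where "d \<in> symmetric_partitions V" "e = insert {a, swap_vertex a} d"
  | d where "d \<in> symmetric_partitions V" "e = insert {a} (insert {swap_vertex a} d)"
  | d B where "d \<in> symmetric_partitions V" "B \<in> d" "e = join_block a B ` d"
proof -
  let ?d = "restrict_partition a e"
  have d: "?d \<in> symmetric_partitions V" by (rule restrict_partition_symmetric[OF e])
  have part: "partition_on (insert a (insert (swap_vertex a) V)) e"
    and sw: "\<And>C. C \<in> e \<Longrightarrow> swap_vertex ` C \<in> e"
    using e by (auto simp: symmetric_partitions_def flip_eq_iff)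
  have ne: "{} \<notin> e" using part by (simp add: partition_on_def)
  obtain A where A: "A \<in> e" "a \<in> A" using part by (auto simp: partition_on_def)
  note eq = partition_on_block_eq[OF part]
  have A': "swap_vertex ` A \<in> e" "swap_vertex a \<in> swap_vertex ` A" using A sw by auto
  have memA: "a \<in> C \<longleftrightarrow> C = A" "swap_vertex a \<in> C \<longleftrightarrow> C = swap_vertex ` A" if "C \<in> e" for C
    using A A' eq that by metis+
  have other: "C - {a, swap_vertex a} = C" if "C \<in> e" "C \<noteq> A" "C \<noteq> swap_vertex ` A" for C
    using memA[OF that(1)] that by auto
  show thesis
  proof (cases "A - {a, swap_vertex a} = {}")
    case True
    \<comment> \<open>Deletion empties both \<open>A\<close> and its mirror image, so
      \<open>X\<close> is all that survives restriction.\<close>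
    define X where "X = e - {A, swap_vertex ` A}"
    have e_eq: "e = insert A (insert (swap_vertex ` A) X)" using A A' by (auto simp: X_def)
    have swA: "swap_vertex ` A - {a, swap_vertex a} = {}" using True by auto
    have "(\<lambda>C. C - {a, swap_vertex a}) ` X = (\<lambda>C. C) ` X"
      by (intro image_cong refl other) (auto simp: X_def)
    then have "?d = X"
      using True swA ne unfolding restrict_partition_def by (subst e_eq) (simp add: X_def)
    then have e_eq': "e = insert A (insert (swap_vertex ` A) ?d)" using e_eq by simp
    consider "A = {a, swap_vertex a}" | "A = {a}" using True A by auto
    then show thesis
    proof cases
      case 1
      then have "swap_vertex ` A = A" by auto
      then have "e = insert {a, swap_vertex a} ?d" using e_eq' 1 by simp
      then show thesis using that(1) d by blast
    next
      case 2
      then have "e = insert {a} (insert {swap_vertex a} ?d)" using e_eq' by simp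
      then show thesis using that(2) d by blast
    qed
  next
    case False
    let ?B = "A - {a, swap_vertex a}"
    have swB: "swap_vertex ` ?B = swap_vertex ` A - {a, swap_vertex a}" by (auto simp: set_eq_iff)
    have neC: "C - {a, swap_vertex a} \<noteq> {}" if "C \<in> e" for C
    proof (cases "C = A \<or> C = swap_vertex ` A")
      case True
      then show ?thesis using False swB by (metis image_is_empty)
    next
      case False
      then show ?thesis using other that ne by force
    qed
    \<comment> \<open>Each block keeps an old vertex by \<open>neC\<close>, and a single vertex
      already identifies its block. Hence deletion merges no two blocks.\<close>
    have inj: "C = D" if CD: "C \<in> e" "D \<in> e" "C - {a, swap_vertex a} = D - {a, swap_vertex a}" for C D
    proof -
      obtain x where "x \<in> C - {a, swap_vertex a}" using neC[OF CD(1)] by blast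
      then show "C = D" using eq[OF CD(1,2), of x] CD(3) by blast
    qed
    then have "C - {a, swap_vertex a} = ?B \<longleftrightarrow> C = A"
      "C - {a, swap_vertex a} = swap_vertex ` ?B \<longleftrightarrow> C = swap_vertex ` A" if "C \<in> e" for C
      using inj[OF that A(1)] inj[OF that A'(1)] swB by metis+
    then have "join_block a ?B (C - {a, swap_vertex a}) = C" if "C \<in> e" for C
      using memA[OF that] that unfolding join_block_def by auto
    moreover have d_eq: "?d = (\<lambda>C. C - {a, swap_vertex a}) ` e"
      using neC by (auto simp: restrict_partition_def)
    ultimately have "e = join_block a ?B ` ?d" by (simp add: image_image)
    moreover have "?B \<in> ?d" using A d_eq by auto
    ultimately show thesis using that(3) d by blast
  qed
qed

text \<open>The three kinds of extension form disjoint families with one more, two more and equally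
  many blocks; the last has one member for each block of \<open>d\<close>. The weight
  \<open>\<phi>\<close> is arbitrary so that it can be taken as a removal-walk count at a fixed
  diagram.\<close>

lemma sum_symmetric_partitions_insert:
  fixes \<phi> :: "nat \<Rightarrow> nat"
  assumes V: "finite V"
  shows "(\<Sum>e\<in>symmetric_partitions (insert a (insert (swap_vertex a) V)). \<phi> (card e))
    = (\<Sum>d\<in>symmetric_partitions V. \<phi> (card d + 1) + \<phi> (card d + 2) + card d * \<phi> (card d))"
proof -
  let ?S = "symmetric_partitions V" and ?a = "swap_vertex a"
  let ?pair = "\<lambda>d. insert {a, ?a} d" and ?single = "\<lambda>d. insert {a} (insert {?a} d)"
    and ?join = "\<lambda>(d, B). join_block a B ` d"
  let ?P = "SIGMA d:?S. d"
  have fin: "finite ?S" "\<And>d. d \<in> ?S \<Longrightarrow> finite d"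
    using V finite_symmetric_partitions finite_elements[OF V]
    by (auto simp: symmetric_partitions_def)
  have ext: "symmetric_partitions (insert a (insert ?a V)) = (?pair ` ?S \<union> ?single ` ?S) \<union> ?join ` ?P"
  proof
    show "symmetric_partitions (insert a (insert ?a V)) \<subseteq> (?pair ` ?S \<union> ?single ` ?S) \<union> ?join ` ?P"
    proof
      fix e assume "e \<in> symmetric_partitions (insert a (insert ?a V))"
      then show "e \<in> (?pair ` ?S \<union> ?single ` ?S) \<union> ?join ` ?P"
      proof (cases rule: symmetric_partition_cases)
        case (1 d)
        then show ?thesis by (intro UnI1 image_eqI[of _ _ d])
      next
        case (2 d)
        then show ?thesis by (intro UnI1 UnI2 image_eqI[of _ _ d])
      next
        case (3 d B)
        then show ?thesis by (intro UnI2 image_eqI[of _ _ "(d, B)"] SigmaI) simp_all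
      qed
    qed
    have "?join p \<in> symmetric_partitions (insert a (insert ?a V))" if "p \<in> ?P" for p
      using that join_block_symmetric[of "fst p" "snd p"] by (cases p) simp
    then show "(?pair ` ?S \<union> ?single ` ?S) \<union> ?join ` ?P \<subseteq> symmetric_partitions (insert a (insert ?a V))"
      by (intro Un_least image_subsetI insert_pair_symmetric insert_singletons_symmetric)
  qed
  \<comment> \<open>A joined block retains an old vertex, so neither the new pair nor a new
    singleton can be a block. This separates the joins from the other two families.\<close>
  have join_new: "\<not> C \<subseteq> {a, ?a}" if "d \<in> ?S" "C \<in> join_block a B ` d" for d B C
  proof -
    obtain D where D: "D \<in> d" "C = join_block a B D" using \<open>C \<in> join_block a B ` d\<close> by blast
    then have "C - {a, ?a} = D" "D \<noteq> {}"
      using join_block_minus[OF \<open>d \<in> ?S\<close>] \<open>d \<in> ?S\<close>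
      by (auto simp: symmetric_partitions_def partition_on_def)
    then show ?thesis by blast
  qed
  have "?pair d \<noteq> ?single d'" if "d \<in> ?S" for d d'
  proof
    assume "?pair d = ?single d'"
    then have "{a} \<in> ?pair d" by simp
    then have "{a} \<in> d" by (auto simp: doubleton_eq_iff)
    then show False using not_in_block(1)[OF that] by blast
  qed
  then have disj1: "?pair ` ?S \<inter> ?single ` ?S = {}" by blast
  have "?join p \<noteq> ?pair d" "?join p \<noteq> ?single d" if "p \<in> ?P" for p d
  proof -
    obtain d' B' where p: "p = (d', B')" "d' \<in> ?S" using \<open>p \<in> ?P\<close> by blast
    have *: "{a, ?a} \<notin> ?join p" "{a} \<notin> ?join p"
      using join_new[OF p(2), of _ B'] p(1) by auto
    show "?join p \<noteq> ?pair d"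
    proof
      assume "?join p = ?pair d"
      then show False using *(1) by simp
    qed
    show "?join p \<noteq> ?single d"
    proof
      assume "?join p = ?single d"
      then show False using *(2) by simp
    qed
  qed
  then have disj2: "(?pair ` ?S \<union> ?single ` ?S) \<inter> ?join ` ?P = {}"
    unfolding disjoint_iff by (metis (no_types, lifting) UnE imageE)
  have inj: "inj_on ?pair ?S" "inj_on ?single ?S"
    by (rule inj_on_inverseI[of _ "restrict_partition a"], erule restrict_partition_extensions)+
  have inj_join: "inj_on ?join ?P"
  proof (rule inj_onI, clarsimp)
    fix d B d' B'
    assume *: "d \<in> ?S" "B \<in> d" "d' \<in> ?S" "B' \<in> d'" "join_block a B ` d = join_block a B' ` d'"
    then have dd: "d = d'" by (metis restrict_partition_extensions(3))
    \<comment> \<open>The block containing \<open>a\<close> reveals the choice made: its old part is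
      \<open>B\<close> on one side and \<open>B'\<close> on the other.\<close>
    have "join_block a B B \<in> join_block a B' ` d" using * dd by auto
    then obtain C where C: "C \<in> d" "join_block a B B = join_block a B' C" by auto
    then have "B = C" using join_block_minus[OF *(1)] *(2) by metis
    moreover have "C = B'"
      using mem_join_block[OF *(1,2), of B] mem_join_block[OF *(1) C(1), of B'] C(2) by simp
    ultimately show "d = d' \<and> B = B'" using dd by simp
  qed
  have card_pair: "card (?pair d) = card d + 1" and card_single: "card (?single d) = card d + 2"
    if "d \<in> ?S" for d
    using not_in_block[OF that] fin(2)[OF that] by (auto simp: card_insert_if)
  have card_join: "card (join_block a B ` d) = card d" if "d \<in> ?S" for d B
    by (rule card_image, rule inj_on_inverseI[of _ "\<lambda>C. C - {a, ?a}"]) (rule join_block_minus[OF that])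
  have finP: "finite ?P" using fin by auto
  have "(\<Sum>e\<in>symmetric_partitions (insert a (insert ?a V)). \<phi> (card e))
      = (\<Sum>d\<in>?S. \<phi> (card (?pair d))) + (\<Sum>d\<in>?S. \<phi> (card (?single d)))
        + (\<Sum>p\<in>?P. \<phi> (card (?join p)))"
    unfolding ext using fin finP disj1 disj2
    by (simp add: sum.union_disjoint sum.reindex inj inj_join)
  also have "(\<Sum>p\<in>?P. \<phi> (card (?join p))) = (\<Sum>(d, B)\<in>?P. \<phi> (card d))"
    by (rule sum.cong) (auto simp: card_join)
  also have "\<dots> = (\<Sum>d\<in>?S. card d * \<phi> (card d))"
    using fin by (simp add: sum.Sigma[symmetric])
  finally show ?thesis by (simp add: card_pair card_single sum.distrib)
qed

end

section \<open>Walk counts expressed through symmetric partitions\<close>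

lemma symmetric_partitions_empty: "symmetric_partitions {} = {{}}"
  by (auto simp: symmetric_partitions_def partition_on_empty flip_def)

lemma vertices_0: "vertices 0 = {}"
  by (simp add: vertices_def)

lemma vertices_Suc:
  "vertices (Suc m) = insert (Inl (Suc m)) (insert (swap_vertex (Inl (Suc m))) (vertices m))"
  by (auto simp: vertices_def)

text \<open>Prepending a round to the walk corresponds to adding a mirror pair of vertices. The
  diagram \<open>f\<close> stays general because the first round moves the start, and linearity
  carries the operators through the sum over partitions.\<close>

lemma vacillating_walks_eq:
  "young f \<Longrightarrow> vacillating_walks m f
    = (\<Sum>d\<in>symmetric_partitions (vertices m). removal_walks (card d) f)"
proof (induction m arbitrary: f)
  case 0
  then show ?case by (simp add: vertices_0 symmetric_partitions_empty)
next
  case (Suc m)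
  let ?S = "symmetric_partitions (vertices m)" and ?a = "Inl (Suc m) :: nat + nat"
  have a: "?a \<notin> vertices m" "swap_vertex ?a \<notin> vertices m" and fin: "finite (vertices m)"
    by (auto simp: vertices_def)
  have "vacillating_walks (Suc m) f
      = stay_or_remove (stay_or_add (\<lambda>g. \<Sum>d\<in>?S. removal_walks (card d) g)) f"
    unfolding vacillating_walks_simps
    by (intro stay_or_remove_cong stay_or_add_cong Suc.IH Suc.prems)
  also have "\<dots> = (\<Sum>d\<in>?S. stay_or_remove (stay_or_add (removal_walks (card d))) f)"
    unfolding stay_or_add_sum stay_or_remove_linear(3) ..
  also have "\<dots> = (\<Sum>d\<in>?S. removal_walks (card d + 1) f + removal_walks (card d + 2) f
      + card d * removal_walks (card d) f)"
    by (intro sum.cong refl stay_or_remove_add_removal_walks Suc.prems)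
  also have "\<dots> = (\<Sum>d\<in>symmetric_partitions (vertices (Suc m)). removal_walks (card d) f)"
    unfolding vertices_Suc
    by (rule sum_symmetric_partitions_insert[OF a fin, of "\<lambda>b. removal_walks b f", symmetric])
  finally show ?case .
qed

section \<open>Vacillating tableaux\<close>

definition row :: "nat list \<Rightarrow> nat \<Rightarrow> nat" where
  "row l i = (if i < length l then l ! i else 0)"

lemma young_diagram_row: "young_diagram l = {(i, j). j < row l i}"
  by (auto simp: young_diagram_def row_def split: if_splits)

lemma row_pos_iff: "int_partition l \<Longrightarrow> 0 < row l i \<longleftrightarrow> i < length l"
  unfolding int_partition_def row_def by (metis gr0I nat_neq_iff nth_mem)

text \<open>Parts are positive, so the zeros of the row function determine the length of the
  list.\<close>

lemma row_inject:
  assumes "int_partition l" "int_partition m" "row l = row m"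
  shows "l = m"
proof (rule nth_equalityI)
  have "i < length l \<longleftrightarrow> i < length m" for i
    using assms by (metis row_pos_iff)
  then show len: "length l = length m" by (metis linorder_neqE_nat less_irrefl)
  show "l ! i = m ! i" if "i < length l" for i
    using fun_cong[OF assms(3), of i] that len by (simp add: row_def)
qed

lemma young_row:
  assumes "int_partition l"
  shows "young (row l)"
proof (rule youngI)
  show "row l (Suc i) \<le> row l i" for i
    using assms unfolding int_partition_def row_def by (auto simp: sorted_wrt_iff_nth_less)
  show "row l (length l) = 0" by (simp add: row_def)
qed

lemma row_surj:
  assumes "young f"
  obtains l where "int_partition l" "row l = f"
proof -
  \<comment> \<open>The first empty row: the entries before it are positive, and by monotonicity all
    later ones are zero.\<close>
  define n where "n = (LEAST n. f n = 0)"
  have mono: "i \<le> j \<Longrightarrow> f j \<le> f i" for i j using assms by (simp add: young_def antimonoD)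
  have n: "f n = 0" unfolding n_def using assms by (auto simp: young_def intro: LeastI)
  have pos: "f i > 0" if "i < n" for i using that not_less_Least unfolding n_def by blast
  have zero: "f i = 0" if "\<not> i < n" for i using mono[of n i] n that by simp
  show thesis
  proof
    show "int_partition (map f [0..<n])"
      unfolding int_partition_def using mono pos by (fastforce simp: sorted_wrt_iff_nth_less)
    show "row (map f [0..<n]) = f" using zero by (auto simp: row_def)
  qed
qed

lemma remove_box_iff_add_box: "remove_box l m \<longleftrightarrow> add_box m l"
  unfolding remove_box_def add_box_def by (metis Diff_insert_absorb Diff_iff insertI1 insert_Diff)

text \<open>Rows of a diagram are initial segments, so a single extra box can only sit at the end of
  its row.\<close>

lemma add_box_iff_row:
  "add_box l m \<longleftrightarrow> (\<exists>i. row m = inc (row l) i)"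
proof
  assume "add_box l m"
  then obtain i j where ij: "row l i \<le> j" "\<And>i' j'. j' < row m i' \<longleftrightarrow> i' = i \<and> j' = j \<or> j' < row l i'"
    unfolding add_box_def young_diagram_row by (auto simp: set_eq_iff not_less)
  have "row l i = j"
    using ij(2)[of j i] ij(2)[of "row l i" i] ij(1) by auto
  have "row m i' = inc (row l) i i'" for i'
  proof (cases "i' = i")
    case True
    then have "j' < row m i \<longleftrightarrow> j' < Suc j" for j' using ij(2)[of j' i] \<open>row l i = j\<close> by auto
    then have "row m i = Suc j" by (metis linorder_neqE_nat less_irrefl)
    then show ?thesis using True \<open>row l i = j\<close> by (simp add: inc_def)
  next
    case False
    then have "j' < row m i' \<longleftrightarrow> j' < row l i'" for j' using ij(2)[of j' i'] by auto
    then have "row m i' = row l i'" by (metis linorder_neqE_nat less_irrefl)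
    then show ?thesis using False by (simp add: inc_def)
  qed
  then show "\<exists>i. row m = inc (row l) i" by blast
next
  assume "\<exists>i. row m = inc (row l) i"
  then obtain i where "row m = inc (row l) i" by blast
  then have "young_diagram m = insert (i, row l i) (young_diagram l)"
    by (auto simp: young_diagram_row inc_def split: if_splits)
  then show "add_box l m" unfolding add_box_def by (auto simp: young_diagram_row)
qed

text \<open>The relation \<open>add_box\<close> by itself permits any row; requiring the result to
  be a partition forces the row to be addable.\<close>

lemma bij_betw_add_box:
  assumes l: "int_partition l"
  shows "bij_betw row {m. int_partition m \<and> add_box l m} (inc (row l) ` addable (row l))"
proof (rule bij_betw_imageI)
  show "inj_on row {m. int_partition m \<and> add_box l m}"
    by (rule inj_onI) (auto intro: row_inject)
  show "row ` {m. int_partition m \<and> add_box l m} = inc (row l) ` addable (row l)"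
  proof (intro equalityI subsetI)
    fix f assume "f \<in> row ` {m. int_partition m \<and> add_box l m}"
    then obtain m where m: "f = row m" "int_partition m" "add_box l m" by blast
    then obtain i where "row m = inc (row l) i" using add_box_iff_row by blast
    then have f: "f = inc (row l) i" "young f" using m young_row[of m] by simp_all
    then have "i \<in> addable (row l)"
      using young_Suc_le[OF f(2), of "i - 1"] by (cases i) (auto simp: inc_def addable_def)
    then show "f \<in> inc (row l) ` addable (row l)" using f by blast
  next
    fix f assume "f \<in> inc (row l) ` addable (row l)"
    then obtain i where i: "f = inc (row l) i" "i \<in> addable (row l)" by blast
    then obtain m where m: "int_partition m" "row m = f"
      using row_surj young_inc[OF young_row[OF l]] by metis
    moreover from this have "add_box l m" using i(1) add_box_iff_row by blast
    ultimately show "f \<in> row ` {m. int_partition m \<and> add_box l m}" by blast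
  qed
qed

lemma bij_betw_remove_box:
  assumes l: "int_partition l"
  shows "bij_betw row {m. int_partition m \<and> remove_box l m} (dec (row l) ` removable (row l))"
proof (rule bij_betw_imageI)
  show "inj_on row {m. int_partition m \<and> remove_box l m}"
    by (rule inj_onI) (auto intro: row_inject)
  show "row ` {m. int_partition m \<and> remove_box l m} = dec (row l) ` removable (row l)"
  proof (intro equalityI subsetI)
    fix f assume "f \<in> row ` {m. int_partition m \<and> remove_box l m}"
    then obtain i where f: "row l = inc f i" "young f"
      by (auto simp: remove_box_iff_add_box add_box_iff_row young_row)
    then have "i \<in> removable (row l)" "f = dec (row l) i"
      using young_Suc_le[OF f(2), of i] by (auto simp: inc_def dec_def removable_def)
    then show "f \<in> dec (row l) ` removable (row l)" by blast
  next
    fix f assume "f \<in> dec (row l) ` removable (row l)"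
    then obtain i where i: "f = dec (row l) i" "i \<in> removable (row l)" by blast
    then obtain m where m: "int_partition m" "row m = f"
      using row_surj young_dec[OF young_row[OF l]] by metis
    moreover have "row l = inc f i" using i by (auto simp: inc_def dec_def removable_def)
    ultimately have "remove_box l m" by (auto simp: remove_box_iff_add_box add_box_iff_row)
    with m show "f \<in> row ` {m. int_partition m \<and> remove_box l m}" by blast
  qed
qed

lemma sum_add_box:
  assumes l: "int_partition l"
  shows "(\<Sum>m | int_partition m \<and> add_box l m. \<phi> (row m)) = (\<Sum>i\<in>addable (row l). \<phi> (inc (row l) i))"
proof -
  have "inj (inc (row l))" by (rule injI) (metis fun_upd_eqD fun_upd_same fun_upd_other inc_def n_not_Suc_n)
  then show ?thesis
    using sum.reindex_bij_betw[OF bij_betw_add_box[OF l], of \<phi>]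
    by (simp add: sum.reindex inj_on_subset)
qed

lemma sum_remove_box:
  assumes l: "int_partition l"
  shows "(\<Sum>m | int_partition m \<and> remove_box l m. \<phi> (row m))
    = (\<Sum>i\<in>removable (row l). \<phi> (dec (row l) i))"
proof -
  \<comment> \<open>The restriction to removable rows matters: by truncated subtraction,
    \<open>dec\<close> at any empty row changes nothing.\<close>
  have "inj_on (dec (row l)) (removable (row l))"
  proof (rule inj_onI)
    fix i j assume i: "i \<in> removable (row l)" and eq: "dec (row l) i = dec (row l) j"
    show "i = j"
      using i fun_cong[OF eq, of i] by (auto simp: dec_def removable_def split: if_splits)
  qed
  then show ?thesis
    using sum.reindex_bij_betw[OF bij_betw_remove_box[OF l], of \<phi>]
    by (simp add: sum.reindex)
qed

lemma finite_add_box: "int_partition l \<Longrightarrow> finite {m. int_partition m \<and> add_box l m}"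
  using bij_betw_finite[OF bij_betw_add_box] finite_addable young_row by blast

lemma finite_remove_box: "int_partition l \<Longrightarrow> finite {m. int_partition m \<and> remove_box l m}"
  using bij_betw_finite[OF bij_betw_remove_box] finite_removable young_row by blast

lemma sum_list_young_diagram: "sum_list l = card (young_diagram l)"
  and finite_young_diagram: "finite (young_diagram l)"
proof -
  have "young_diagram l = Sigma {..<length l} (\<lambda>i. {..<l ! i})"
    by (auto simp: young_diagram_def)
  then show "sum_list l = card (young_diagram l)" "finite (young_diagram l)"
    by (simp_all add: sum_list_sum_nth atLeast0LessThan)
qed

lemma sum_list_add_box: "add_box l m \<Longrightarrow> sum_list m = Suc (sum_list l)"
  using finite_young_diagram[of l] by (auto simp: add_box_def sum_list_young_diagram)

definition stay_or_add_box :: "nat list \<Rightarrow> nat list set" where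
  "stay_or_add_box l = insert l {m. int_partition m \<and> add_box l m}"

definition stay_or_remove_box :: "nat list \<Rightarrow> nat list set" where
  "stay_or_remove_box l = insert l {m. int_partition m \<and> remove_box l m}"

lemma sum_stay_or_add_box:
  assumes l: "int_partition l"
  shows "(\<Sum>m\<in>stay_or_add_box l. \<phi> (row m)) = stay_or_add \<phi> (row l)"
proof -
  \<comment> \<open>Adding a box changes the size, so the option of staying is not counted
    twice.\<close>
  have "\<not> add_box l l" using sum_list_add_box by fastforce
  then show ?thesis
    by (simp add: stay_or_add_box_def stay_or_add_def finite_add_box[OF l] sum_add_box[OF l])
qed

lemma sum_stay_or_remove_box:
  assumes l: "int_partition l"
  shows "(\<Sum>m\<in>stay_or_remove_box l. \<phi> (row m)) = stay_or_remove \<phi> (row l)"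
proof -
  have "\<not> remove_box l l" using sum_list_add_box remove_box_iff_add_box by fastforce
  then show ?thesis
    by (simp add: stay_or_remove_box_def stay_or_remove_def finite_remove_box[OF l] sum_remove_box[OF l])
qed

section \<open>Counting tableaux by splitting off the first round\<close>

definition tableaux_from :: "nat \<Rightarrow> nat list \<Rightarrow> nat list list set" where
  "tableaux_from k l = {t.
     length t = 2 * k + 1 \<and> (\<forall>p \<in> set t. int_partition p) \<and> t ! 0 = l \<and>
     (\<forall>i < k.
        (t ! (2 * i + 1) = t ! (2 * i) \<or> remove_box (t ! (2 * i)) (t ! (2 * i + 1))) \<and>
        (t ! (2 * i + 2) = t ! (2 * i + 1) \<or> add_box (t ! (2 * i + 1)) (t ! (2 * i + 2))))}"

lemma vacillating_tableaux_eq: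
  "vacillating_tableaux k l = {t \<in> tableaux_from k []. t ! (2 * k) = l}"
  by (auto simp: vacillating_tableaux_def tableaux_from_def)

lemma tableaux_from_0: "int_partition l \<Longrightarrow> tableaux_from 0 l = {[l]}"
  by (auto simp: tableaux_from_def length_Suc_conv)

text \<open>The round with index 0 splits off, and the remaining conditions, shifted by two entries,
  say that \<open>t\<close> is a tableau starting at its own head.\<close>

lemma Cons_Cons_in_tableaux_from:
  assumes "int_partition l"
  shows "x # p # t \<in> tableaux_from (Suc k) l \<longleftrightarrow>
    x = l \<and> p \<in> stay_or_remove_box l \<and> (\<exists>q \<in> stay_or_add_box p. t \<in> tableaux_from k q)"
proof (cases t)
  case Nil
  then show ?thesis by (simp add: tableaux_from_def)
next
  case (Cons q s)
  then show ?thesis using assms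
    by (simp add: tableaux_from_def All_less_Suc2 stay_or_remove_box_def stay_or_add_box_def) blast
qed

lemma tableaux_from_Suc:
  assumes "int_partition l"
  shows "tableaux_from (Suc k) l
    = (\<Union>p\<in>stay_or_remove_box l. \<Union>q\<in>stay_or_add_box p. (\<lambda>t. l # p # t) ` tableaux_from k q)"
    (is "?L = ?R")
proof (rule set_eqI)
  fix t show "t \<in> ?L \<longleftrightarrow> t \<in> ?R"
  proof (cases "\<exists>x p s. t = x # p # s")
    case True
    then obtain x p s where "t = x # p # s" by blast
    then show ?thesis by (simp add: Cons_Cons_in_tableaux_from[OF assms] image_iff)
  next
    case False
    then have "length t < 2" by (cases t; cases "tl t") auto
    then have "t \<notin> ?L" by (simp add: tableaux_from_def)
    moreover have "t \<notin> ?R" using False by blast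
    ultimately show ?thesis by blast
  qed
qed

lemma int_partition_stay:
  assumes "int_partition l"
  shows "m \<in> stay_or_add_box l \<Longrightarrow> int_partition m" "m \<in> stay_or_remove_box l \<Longrightarrow> int_partition m"
  using assms by (auto simp: stay_or_add_box_def stay_or_remove_box_def)

lemma finite_stay:
  assumes "int_partition l"
  shows "finite (stay_or_add_box l)" "finite (stay_or_remove_box l)"
  using assms by (simp_all add: stay_or_add_box_def stay_or_remove_box_def finite_add_box finite_remove_box)

lemma finite_tableaux_from: "int_partition l \<Longrightarrow> finite (tableaux_from k l)"
proof (induction k arbitrary: l)
  case 0
  then show ?case by (simp add: tableaux_from_0)
next
  case (Suc k)
  show ?case unfolding tableaux_from_Suc[OF Suc.prems]
  proof (intro finite_UN_I finite_imageI finite_stay Suc.prems)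
    fix p assume "p \<in> stay_or_remove_box l"
    then show p: "int_partition p" by (rule int_partition_stay(2)[OF Suc.prems])
    fix q assume "q \<in> stay_or_add_box p"
    then show "finite (tableaux_from k q)" by (rule Suc.IH[OF int_partition_stay(1)[OF p]])
  qed
qed

text \<open>The shapes \<open>p\<close> and \<open>q\<close> are the second and third entries of the
  tableau, so the unions in \<open>tableaux_from_Suc\<close> are disjoint. Cardinalities then obey
  the recursion of \<open>vacillating_walks\<close>.\<close>

lemma card_tableaux_from:
  "int_partition l \<Longrightarrow> card (tableaux_from k l) = vacillating_walks k (row l)"
proof (induction k arbitrary: l)
  case 0
  then show ?case by (simp add: tableaux_from_0)
next
  case (Suc k)
  note l = Suc.prems
  let ?T = "\<lambda>p q. (\<lambda>t. l # p # t) ` tableaux_from k q"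
  let ?X = "\<lambda>p. \<Union>q\<in>stay_or_add_box p. ?T p q"
  have X: "finite (?X p)" "card (?X p) = stay_or_add (vacillating_walks k) (row p)"
    if p: "int_partition p" for p
  proof -
    have fin: "finite (?T p q)" if "q \<in> stay_or_add_box p" for q
      by (intro finite_imageI finite_tableaux_from int_partition_stay(1)[OF p that])
    then show "finite (?X p)" by (intro finite_UN_I finite_stay p)
    have "?T p q \<inter> ?T p q' = {}" if "q \<noteq> q'" for q q'
      using that by (auto simp: tableaux_from_def)
    then have "card (?X p) = (\<Sum>q\<in>stay_or_add_box p. card (?T p q))"
      using fin by (intro card_UN_disjoint finite_stay p) simp_all
    also have "\<dots> = (\<Sum>q\<in>stay_or_add_box p. card (tableaux_from k q))"
      by (intro sum.cong refl card_image) (simp add: inj_on_def)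
    also have "\<dots> = (\<Sum>q\<in>stay_or_add_box p. vacillating_walks k (row q))"
      by (intro sum.cong refl Suc.IH int_partition_stay(1)[OF p])
    also have "\<dots> = stay_or_add (vacillating_walks k) (row p)" by (rule sum_stay_or_add_box[OF p])
    finally show "card (?X p) = stay_or_add (vacillating_walks k) (row p)" .
  qed
  have "?X p \<inter> ?X p' = {}" if "p \<noteq> p'" for p p'
    using that by blast
  then have "card (tableaux_from (Suc k) l) = (\<Sum>p\<in>stay_or_remove_box l. card (?X p))"
    unfolding tableaux_from_Suc[OF l]
    using X(1)[OF int_partition_stay(2)[OF l]]
    by (intro card_UN_disjoint finite_stay l) simp_all
  also have "\<dots> = (\<Sum>p\<in>stay_or_remove_box l. stay_or_add (vacillating_walks k) (row p))"
    by (intro sum.cong refl X(2) int_partition_stay(2)[OF l])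
  also have "\<dots> = vacillating_walks (Suc k) (row l)"
    by (simp add: sum_stay_or_remove_box[OF l])
  finally show ?case .
qed

text \<open>A round increases the size by at most one box. Hence classifying tableaux by final shape
  over \<open>Gamma k\<close> misses none.\<close>

lemma last_in_Gamma:
  assumes t: "t \<in> tableaux_from k []"
  shows "t ! (2 * k) \<in> Gamma k"
proof -
  have "sum_list (t ! (2 * i)) \<le> i" if "i \<le> k" for i
    using that
  proof (induction i)
    case 0
    then show ?case using t by (simp add: tableaux_from_def)
  next
    case (Suc i)
    then have "t ! (2 * i + 1) = t ! (2 * i) \<or> add_box (t ! (2 * i + 1)) (t ! (2 * i))"
      "t ! (2 * i + 2) = t ! (2 * i + 1) \<or> add_box (t ! (2 * i + 1)) (t ! (2 * i + 2))"
      using t by (auto simp: tableaux_from_def remove_box_iff_add_box)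
    then have "sum_list (t ! (2 * i + 2)) \<le> Suc (sum_list (t ! (2 * i)))"
      by (auto dest!: sum_list_add_box)
    then show ?case using Suc by simp
  qed
  moreover have "int_partition (t ! (2 * k))" using t by (simp add: tableaux_from_def)
  ultimately show ?thesis by (simp add: Gamma_def)
qed

lemma finite_Gamma: "finite (Gamma k)"
proof (rule finite_subset)
  have "length l \<le> sum_list l" if "0 \<notin> set l" for l :: "nat list"
    using that by (induction l) auto
  then show "Gamma k \<subseteq> {l. set l \<subseteq> {..k} \<and> length l \<le> k}"
    unfolding Gamma_def int_partition_def by (auto dest: member_le_sum_list intro: order_trans)
  show "finite {l. set l \<subseteq> {..k} \<and> length l \<le> k}" by (rule finite_lists_length_le) simp
qed

theorem mainTheorem4:
  fixes k :: nat
  assumes "k \<ge> 1"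
  shows "card {d \<in> set_partitions k. symmetric d}
    = (\<Sum>l\<in>Gamma k. num_vacillating_tableaux k l)"
proof -
  have nil: "int_partition []" by (simp add: int_partition_def)
  have fin: "finite (tableaux_from k [])" by (rule finite_tableaux_from[OF nil])
  \<comment> \<open>The empty diagram has no removable row, so the only walk stays put and every
    symmetric partition contributes exactly 1.\<close>
  have "removal_walks b (row []) = 1" for b
    by (induction b) (simp_all add: stay_or_remove_def removable_def row_def)
  then have "card (symmetric_partitions (vertices k)) = vacillating_walks k (row [])"
    by (simp add: vacillating_walks_eq[OF young_row[OF nil]])
  also have "\<dots> = card (tableaux_from k [])" by (rule card_tableaux_from[OF nil, symmetric])
  also have "tableaux_from k [] = (\<Union>l\<in>Gamma k. vacillating_tableaux k l)"
    using last_in_Gamma by (auto simp: vacillating_tableaux_eq)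
  also have "card \<dots> = (\<Sum>l\<in>Gamma k. num_vacillating_tableaux k l)"
    unfolding num_vacillating_tableaux_def using fin finite_Gamma
    by (intro card_UN_disjoint) (auto simp: vacillating_tableaux_eq)
  also have "symmetric_partitions (vertices k) = {d \<in> set_partitions k. symmetric d}"
    by (auto simp: symmetric_partitions_def set_partitions_def symmetric_def)
  finally show ?thesis .
qed

end
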